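(* Let $\ell$ be a prime and $n\ge4$ an integer. Let $C_n$ be the cyclic group of order $n$, $C_n'=C_n\setminus\{1\}$, and let $K_n=\mathrm{Cay}(C_n,C_n')$ be the complete graph on $n$ vertices. Let $\beta:C_n'\to\mathbb{Z}_\ell$ satisfy conditions (1)–(4) below, let $\alpha=\alpha_\beta$, and let $\mu_n=\mu_\ell(K_n,\alpha)$, $\lambda_n=\lambda_\ell(K_n,\alpha)$. Suppose $\ell\nmid n$ and $\sum_{s\in C_n'}\beta(s)^2\not\equiv0\pmod\ell$. Then $\mu_n=0$ and $\lambda_n=1$.
   Context: For a finite abelian group $G$ and $S\subseteq G$ with $S$ generating $G$, $S=S^{-1}$, $1\notin S$, $\mathrm{Cay}(G,S)$ has vertices $\{v_g\}$ and a directed edge $e(g_1,g_2)$ from $v_{g_1}$ to $v_{g_2}$ whenever $g_1g_2^{-1}\in S$ (inverse $e(g_2,g_1)$); each vertex has degree $r=\#S$. Conditions on $\beta:S\to\mathbb{Z}_\ell$: (1) its image generates $\mathbb{Z}_\ell$ as a $\mathbb{Z}_\ell$-module; (2) $\beta(s^{-1})=-\beta(s)$; (3) $\beta(S)\subseteq\mathbb{Z}$; (4) there exist $m>0$ and $(h_1,\dots,h_m)\in S^m$ with $h_1\cdots h_m\in S$ and $\beta(h_1\cdots h_m)\not\equiv\sum_i\beta(h_i)\pmod\ell$. Voltage: $\alpha(e(g_1,g_2))=\beta(g_1g_2^{-1})$. Enumerating $G=\{g_1,\dots,g_N\}$, with $\delta_S$ the indicator of $S$ and $(1+T)^b=\sum_k\binom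 bkT^k$, the Iwasawa polynomial is $f_{X,\alpha}(T)=\det\big(r\delta_{ij}-\delta_S(g_ig_j^{-1})(1+T)^{\beta(g_ig_j^{-1})}\big)_{i,j}\in\mathbb{Z}_\ell[\![T]\!]$. Write $f_{X,\alpha}(T)=(1+T)^{-m}T\,g(T)$ with $m\ge0$ minimal such that $g\in\mathbb{Z}_\ell[T]$, and $g=\ell^\mu P u$ with $P$ distinguished and $u\in\mathbb{Z}_\ell[\![T]\!]^\times$ (Weierstrass preparation); $\mu_\ell(X,\alpha):=\mu$, $\lambda_\ell(X,\alpha):=\deg P$. *)

theory Defs
  imports
    "HOL-Algebra.Elementary_Groups"
    "HOL-Computational_Algebra.Polynomial_FPS"
    "Berlekamp_Zassenhaus.Finite_Field"
    "Jordan_Normal_Form.Determinant"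
    "Graph_Theory.Digraph"
begin

subsection \<open>The ring of \<open>\<ell>\<close>-adic integers\<close>

text \<open>
  The prime \<open>\<ell>\<close> is \<open>CARD('p)\<close> for a type \<open>'p\<close> of prime cardinality, and \<open>'p padic_int\<close> is the
  inverse limit of the rings of integers modulo \<open>\<ell> ^ n\<close>.
\<close>

typedef ('p :: prime_card) padic_int =
  "{x :: nat \<Rightarrow> int. \<forall>n. 0 \<le> x n \<and> x n < int CARD('p) ^ n \<and> x (Suc n) mod int CARD('p) ^ n = x n}"
  morphisms padic_res Abs_padic_int
  using prime_card_int[where 'a = 'p] by (intro exI[of _ "\<lambda>_. 0"]) (auto intro: prime_gt_0_int)

setup_lifting type_definition_padic_int

lemma card_pow_pos: "0 < int CARD('p :: prime_card) ^ n"
  by (simp add: prime_card prime_gt_0_nat)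

lemma mod_card_pow_Suc:
  "a mod int CARD('p :: prime_card) ^ Suc n mod int CARD('p) ^ n = a mod int CARD('p) ^ n"
  by (rule mod_mod_cancel) simp

instantiation padic_int :: (prime_card) comm_ring_1
begin

lift_definition zero_padic_int :: "'a padic_int" is "\<lambda>_. 0"
  by (simp add: prime_card prime_gt_0_nat)

lift_definition one_padic_int :: "'a padic_int" is "\<lambda>n. 1 mod int CARD('a) ^ n"
  using card_pow_pos[where 'p = 'a] mod_card_pow_Suc[where 'p = 'a] by simp

lift_definition plus_padic_int :: "'a padic_int \<Rightarrow> 'a padic_int \<Rightarrow> 'a padic_int"
  is "\<lambda>x y n. (x n + y n) mod int CARD('a) ^ n"
  using card_pow_pos[where 'p = 'a] mod_card_pow_Suc[where 'p = 'a]
  by (metis (no_types, lifting) mod_add_eq pos_mod_bound pos_mod_sign)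

lift_definition uminus_padic_int :: "'a padic_int \<Rightarrow> 'a padic_int"
  is "\<lambda>x n. (- x n) mod int CARD('a) ^ n"
  using card_pow_pos[where 'p = 'a] mod_card_pow_Suc[where 'p = 'a]
  by (metis (no_types, lifting) mod_minus_eq pos_mod_bound pos_mod_sign)

lift_definition minus_padic_int :: "'a padic_int \<Rightarrow> 'a padic_int \<Rightarrow> 'a padic_int"
  is "\<lambda>x y n. (x n - y n) mod int CARD('a) ^ n"
  using card_pow_pos[where 'p = 'a] mod_card_pow_Suc[where 'p = 'a]
  by (metis (no_types, lifting) mod_diff_eq pos_mod_bound pos_mod_sign)

lift_definition times_padic_int :: "'a padic_int \<Rightarrow> 'a padic_int \<Rightarrow> 'a padic_int"
  is "\<lambda>x y n. (x n * y n) mod int CARD('a) ^ n"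
  using card_pow_pos[where 'p = 'a] mod_card_pow_Suc[where 'p = 'a]
  by (metis (no_types, lifting) mod_mult_eq pos_mod_bound pos_mod_sign)

instance
proof
  fix a b c :: "'a padic_int"
  show "a * b * c = a * (b * c)"
    by transfer (auto simp: fun_eq_iff mod_simps algebra_simps)
  show "a * b = b * a"
    by transfer (auto simp: fun_eq_iff mod_simps algebra_simps)
  show "1 * a = a"
    by transfer (auto simp: fun_eq_iff mod_simps)
  show "a + b + c = a + (b + c)"
    by transfer (auto simp: fun_eq_iff mod_simps algebra_simps)
  show "a + b = b + a"
    by transfer (auto simp: fun_eq_iff mod_simps algebra_simps)
  show "0 + a = a"
    by transfer (auto simp: fun_eq_iff mod_simps)
  show "- a + a = 0"
    by transfer (auto simp: fun_eq_iff mod_simps)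
  show "a - b = a + - b"
    by transfer (auto simp: fun_eq_iff mod_simps)
  show "(a + b) * c = a * c + b * c"
    by transfer (auto simp: fun_eq_iff mod_simps algebra_simps)
  have "1 < int CARD('a)"
    using prime_gt_1_nat[OF prime_card[where 'a = 'a]] by simp
  then show "0 \<noteq> (1 :: 'a padic_int)"
    by transfer (auto simp: fun_eq_iff intro!: exI[of _ 1])
qed

end

lemma padic_int_eqI: "(\<And>n. padic_res x n = padic_res y n) \<Longrightarrow> x = y"
  by (simp add: padic_res_inject[symmetric] fun_eq_iff)

lemma padic_res_mod [simp]:
  "padic_res (x :: 'p :: prime_card padic_int) n mod int CARD('p) ^ n = padic_res x n"
  by transfer simp

lemma padic_res_mod_le:
  assumes "m \<le> n"
  shows "padic_res (x :: 'p :: prime_card padic_int) n mod int CARD('p) ^ m = padic_res x m"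
  using assms
proof (induction rule: dec_induct)
  case (step n)
  have "padic_res x (Suc n) mod int CARD('p) ^ m
      = padic_res x (Suc n) mod int CARD('p) ^ n mod int CARD('p) ^ m"
    by (rule mod_mod_cancel[symmetric]) (simp add: le_imp_power_dvd step.hyps)
  also have "padic_res x (Suc n) mod int CARD('p) ^ n = padic_res x n"
    by transfer simp
  finally show ?case using step.IH by simp
qed simp

lemma padic_res_add:
  "padic_res (x + y :: 'p :: prime_card padic_int) n
     = (padic_res x n + padic_res y n) mod int CARD('p) ^ n"
  by transfer simp

lemma padic_res_diff:
  "padic_res (x - y :: 'p :: prime_card padic_int) n
     = (padic_res x n - padic_res y n) mod int CARD('p) ^ n"
  by transfer simp

lemma padic_res_mult:
  "padic_res (x * y :: 'p :: prime_card padic_int) n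
     = (padic_res x n * padic_res y n) mod int CARD('p) ^ n"
  by transfer simp

lemma padic_res_0 [simp]: "padic_res 0 n = 0"
  by transfer simp

lemma padic_res_1: "padic_res (1 :: 'p :: prime_card padic_int) n = 1 mod int CARD('p) ^ n"
  by transfer simp

lemma padic_res_of_nat:
  "padic_res (of_nat k :: 'p :: prime_card padic_int) n = int k mod int CARD('p) ^ n"
  by (induction k) (simp_all add: padic_res_add padic_res_1 mod_simps)

lemma padic_res_of_int:
  "padic_res (of_int k :: 'p :: prime_card padic_int) n = k mod int CARD('p) ^ n"
  by (cases k rule: int_cases2)
     (simp_all add: padic_res_of_nat uminus_padic_int.rep_eq mod_simps)

instance padic_int :: (prime_card) ring_char_0
proof
  show "inj (of_nat :: nat \<Rightarrow> 'a padic_int)"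
  proof (rule injI)
    fix k m :: nat
    assume eq: "(of_nat k :: 'a padic_int) = of_nat m"
    define n where "n = k + m"
    have gt: "n < CARD('a) ^ n"
      using prime_gt_1_nat[OF prime_card[where 'a = 'a]] by (simp add: power_gt_expt)
    have "int k mod int CARD('a) ^ n = int m mod int CARD('a) ^ n"
      using eq by (metis padic_res_of_nat)
    moreover have "int k < int CARD('a) ^ n" "int m < int CARD('a) ^ n"
      using gt unfolding n_def by (simp_all flip: of_nat_power)
    ultimately show "k = m" by simp
  qed
qed

instance padic_int :: (prime_card) idom
proof
  fix x y :: "'a padic_int"
  assume "x \<noteq> 0" "y \<noteq> 0"
  then obtain a b where a: "padic_res x a \<noteq> 0" and b: "padic_res y b \<noteq> 0"
    by (metis padic_int_eqI padic_res_0)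
  let ?l = "int CARD('a)"
  let ?n = "a + b"
  have l: "prime_elem ?l" using prime_card_int[where 'a = 'a] by blast
  have nx: "\<not> ?l ^ a dvd padic_res x ?n" and ny: "\<not> ?l ^ b dvd padic_res y ?n"
    using a b padic_res_mod_le[of a ?n x] padic_res_mod_le[of b ?n y] by (auto simp: dvd_eq_mod_eq_0)
  then have nz: "padic_res x ?n \<noteq> 0" "padic_res y ?n \<noteq> 0" by auto
  have nu: "\<not> is_unit ?l" using prime_gt_1_nat[OF prime_card[where 'a = 'a]] by simp
  have "multiplicity ?l (padic_res x ?n) < a" "multiplicity ?l (padic_res y ?n) < b"
    using nx ny nz nu by (simp_all add: power_dvd_iff_le_multiplicity)
  then have "multiplicity ?l (padic_res x ?n * padic_res y ?n) < ?n"
    using nz l by (simp add: prime_elem_multiplicity_mult_distrib)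
  then have "\<not> ?l ^ ?n dvd padic_res x ?n * padic_res y ?n"
    using nz nu by (simp add: power_dvd_iff_le_multiplicity)
  then have "padic_res (x * y) ?n \<noteq> 0"
    by (simp add: padic_res_mult dvd_eq_mod_eq_0)
  then show "x * y \<noteq> 0" by auto
qed

instantiation padic_int :: (prime_card) idom_divide
begin

text \<open>Exact division; the value is unspecified if \<open>y \<noteq> 0\<close> does not divide \<open>x\<close>.\<close>

definition divide_padic_int :: "'a padic_int \<Rightarrow> 'a padic_int \<Rightarrow> 'a padic_int" where
  "divide_padic_int x y = (if y = 0 then 0 else THE z. z * y = x)"

instance
  by standard (auto simp: divide_padic_int_def)

end

instance padic_int :: (prime_card) algebraic_semidom ..

lemma card_pow_dvd_padic_int_iff:
  "of_nat CARD('p) ^ n dvd (x :: 'p :: prime_card padic_int) \<longleftrightarrow> padic_res x n = 0"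
proof
  assume "of_nat CARD('p) ^ n dvd x"
  then obtain y where "x = of_nat (CARD('p) ^ n) * y" by (auto simp: dvd_def)
  then show "padic_res x n = 0"
    by (simp add: padic_res_mult padic_res_of_nat del: of_nat_power) simp
next
  assume 0: "padic_res x n = 0"
  let ?l = "int CARD('p)"
  have pos: "0 < ?l ^ k" for k by (rule card_pow_pos)
  have dv: "?l ^ n dvd padic_res x (k + n)" for k
    using 0 padic_res_mod_le[of n "k + n" x] by (simp add: dvd_eq_mod_eq_0)
  define y where "y = (\<lambda>k. padic_res x (k + n) div ?l ^ n)"
  have y: "padic_res x (k + n) = ?l ^ n * y k" for k
    using dv by (simp add: y_def)
  have bnd: "0 \<le> padic_res x k \<and> padic_res x k < ?l ^ k" for k
    by transfer simp
  have *: "0 \<le> y k \<and> y k < ?l ^ k \<and> y (Suc k) mod ?l ^ k = y k" for k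
  proof -
    have "0 \<le> ?l ^ n * y k" "?l ^ n * y k < ?l ^ n * ?l ^ k"
      using bnd[of "k + n"] unfolding y by (simp_all add: power_add mult.commute)
    then have "0 \<le> y k" "y k < ?l ^ k"
      using pos[of n] by (auto simp: zero_le_mult_iff)
    moreover have "?l ^ n * (y (Suc k) mod ?l ^ k) = ?l ^ n * y k"
    proof -
      have "?l ^ n * y (Suc k) mod ?l ^ (n + k) = ?l ^ n * y k"
        using padic_res_mod_le[of "k + n" "Suc k + n" x] y[of k] y[of "Suc k"]
        by (simp only: add.commute le_add2 add_Suc_right le_SucI)
      then show ?thesis by (simp only: power_add mult_mod_right)
    qed
    ultimately show ?thesis using pos[of n] by simp
  qed
  then have rep: "padic_res (Abs_padic_int y :: 'p padic_int) = y"
    by (intro Abs_padic_int_inverse) simp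
  have "x = of_nat (CARD('p) ^ n) * Abs_padic_int y"
  proof (rule padic_int_eqI)
    fix k
    have "padic_res (of_nat (CARD('p) ^ n) * Abs_padic_int y :: 'p padic_int) k
        = ?l ^ n * y k mod ?l ^ k"
      by (simp add: padic_res_mult padic_res_of_nat rep mod_simps del: of_nat_power) simp
    also have "\<dots> = padic_res x k"
      using padic_res_mod_le[of k "k + n" x] by (simp add: y)
    finally show "padic_res x k = padic_res (of_nat (CARD('p) ^ n) * Abs_padic_int y :: 'p padic_int) k"
      by (rule sym)
  qed
  then show "of_nat CARD('p) ^ n dvd x" by simp
qed

lemma is_unit_padic_int_of_nat:
  assumes "\<not> CARD('p) dvd k"
  shows "is_unit (of_nat k :: 'p :: prime_card padic_int)"
proof -
  let ?l = "int CARD('p)"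
  have cop: "coprime (int k) (?l ^ n)" for n
    using assms prime_imp_coprime[OF prime_card[where 'a = 'p], of k]
    by (simp add: coprime_commute)
  have "\<exists>y. 0 \<le> y \<and> y < ?l ^ n \<and> int k * y mod ?l ^ n = 1 mod ?l ^ n" for n
  proof -
    obtain z where "[int k * z = 1] (mod ?l ^ n)"
      using cong_solve_coprime_int[OF cop] by blast
    then show ?thesis
      using card_pow_pos[where 'p = 'p, of n]
      by (intro exI[of _ "z mod ?l ^ n"]) (simp add: cong_def mod_simps)
  qed
  then obtain y where y: "0 \<le> y n" "y n < ?l ^ n" "int k * y n mod ?l ^ n = 1 mod ?l ^ n" for n
    by metis
  have "y (Suc n) mod ?l ^ n = y n" for n
  proof -
    have "int k * y (Suc n) mod ?l ^ n = 1 mod ?l ^ n"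
      using y(3)[of "Suc n"] mod_card_pow_Suc[where 'p = 'p] by metis
    then have "[int k * y (Suc n) = int k * y n] (mod ?l ^ n)"
      using y(3)[of n] by (simp add: cong_def)
    then have "[y (Suc n) = y n] (mod ?l ^ n)"
      using cop[of n] by (simp add: cong_mult_lcancel)
    then show ?thesis using y(1,2)[of n] by (simp add: cong_def)
  qed
  then have rep: "padic_res (Abs_padic_int y :: 'p padic_int) = y"
    using y by (intro Abs_padic_int_inverse) simp
  have "of_nat k * Abs_padic_int y = (1 :: 'p padic_int)"
    by (rule padic_int_eqI)
       (simp add: padic_res_mult padic_res_of_nat padic_res_1 rep mod_simps y(3))
  then show ?thesis by (metis dvd_triv_left)
qed

text \<open>
  The definition of \<open>b gchoose k\<close>, which is not available outside fields because of its sort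
  constraint. The division is exact, as \<open>k!\<close> divides the falling factorial of any \<open>\<ell>\<close>-adic integer.
\<close>

definition padic_binomial :: "'p :: prime_card padic_int \<Rightarrow> nat \<Rightarrow> 'p padic_int" where
  "padic_binomial b k = (\<Prod>i = 0..<k. b - of_nat i) div fact k"

lemma fact_times_padic_binomial:
  fixes b :: "'p :: prime_card padic_int"
  shows "fact k * padic_binomial b k = (\<Prod>i = 0..<k. b - of_nat i)"
proof -
  define v where "v = multiplicity CARD('p) (fact k :: nat)"
  obtain w where w: "fact k = CARD('p) ^ v * w" "\<not> CARD('p) dvd w"
    using multiplicity_decompose'[of "fact k :: nat" "CARD('p)"] prime_card[where 'a = 'p]
    unfolding v_def by (metis fact_nonzero not_prime_unit)
  define a where "a = padic_res b v"
  have "padic_res (\<Prod>i\<in>A. b - of_nat i) v = (\<Prod>i\<in>A. a - int i) mod int CARD('p) ^ v"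
    if "finite A" for A
    using that
  proof (induction A rule: finite_induct)
    case (insert i A)
    then show ?case
      by (simp add: padic_res_mult padic_res_diff padic_res_of_nat a_def mod_simps)
  qed (simp add: padic_res_1)
  moreover have "int (CARD('p) ^ v) dvd (\<Prod>i = 0..<k. a - int i)"
  proof -
    have "(fact k :: int) dvd (\<Prod>i = 0..<k. a - int i)"
      by (rule dvdI[OF gbinomial_int_mult_fact[symmetric]])
    moreover have "(fact k :: int) = int (CARD('p) ^ v) * int w"
      by (metis w(1) of_nat_fact of_nat_mult)
    ultimately show ?thesis by (metis dvd_mult_left)
  qed
  ultimately have "of_nat CARD('p) ^ v dvd (\<Prod>i = 0..<k. b - of_nat i)"
    by (simp add: card_pow_dvd_padic_int_iff dvd_eq_mod_eq_0)
  moreover have "is_unit (of_nat w :: 'p padic_int)"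
    using w by (intro is_unit_padic_int_of_nat)
  moreover have "(fact k :: 'p padic_int) = of_nat CARD('p) ^ v * of_nat w"
    using w(1) by (metis of_nat_fact of_nat_mult of_nat_power)
  ultimately have "(fact k :: 'p padic_int) dvd (\<Prod>i = 0..<k. b - of_nat i)"
    by (simp add: mult_unit_dvd_iff)
  then show ?thesis by (simp add: padic_binomial_def)
qed

lemma module_padic_int: "Modules.module ((*) :: 'p :: prime_card padic_int \<Rightarrow> _)"
  by standard (simp_all add: algebra_simps)

definition one_plus_T_pow :: "'p :: prime_card padic_int \<Rightarrow> 'p padic_int fps" where
  "one_plus_T_pow b = Abs_fps (padic_binomial b)"

subsection \<open>Cayley graphs and their Iwasawa polynomials\<close>

definition cayley_graph :: "('g, 'm) monoid_scheme \<Rightarrow> 'g set \<Rightarrow> ('g, 'g \<times> 'g) pre_digraph" where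
  "cayley_graph G S =
     \<lparr>verts = carrier G,
      arcs = {(x, y). x \<in> carrier G \<and> y \<in> carrier G \<and> x \<otimes>\<^bsub>G\<^esub> inv\<^bsub>G\<^esub> y \<in> S},
      tail = fst, head = snd\<rparr>"

definition cayley_voltage :: "('g, 'm) monoid_scheme \<Rightarrow> ('g \<Rightarrow> 'b) \<Rightarrow> 'g \<times> 'g \<Rightarrow> 'b" where
  "cayley_voltage G \<beta> = (\<lambda>(x, y). \<beta> (x \<otimes>\<^bsub>G\<^esub> inv\<^bsub>G\<^esub> y))"

text \<open>Degree matrix minus voltage-weighted adjacency matrix, for an enumeration of the vertices.\<close>

definition iwasawa_matrix ::
  "('v, 'e) pre_digraph \<Rightarrow> ('e \<Rightarrow> 'p :: prime_card padic_int) \<Rightarrow> 'v list \<Rightarrow> 'p padic_int fps mat"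
where
  "iwasawa_matrix X \<alpha> vs = mat (length vs) (length vs) (\<lambda>(i, j).
     (if i = j then of_nat (out_degree X (vs ! i)) else 0)
       - (\<Sum>e | e \<in> arcs X \<and> tail X e = vs ! i \<and> head X e = vs ! j. one_plus_T_pow (\<alpha> e)))"

definition iwasawa_poly ::
  "('v, 'e) pre_digraph \<Rightarrow> ('e \<Rightarrow> 'p :: prime_card padic_int) \<Rightarrow> 'p padic_int fps"
where
  "iwasawa_poly X \<alpha> = det (iwasawa_matrix X \<alpha> (SOME vs. distinct vs \<and> set vs = verts X))"

definition iwasawa_exponent :: "'a :: comm_ring_1 fps \<Rightarrow> nat" where
  "iwasawa_exponent f = (LEAST m. \<exists>g. (1 + fps_X) ^ m * f = fps_X * fps_of_poly g)"

text \<open>The polynomial \<open>g\<close> with \<open>f = (1 + T)\<^sup>-\<^sup>m T g\<close> for the minimal \<open>m\<close>.\<close>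

definition iwasawa_numerator :: "'a :: comm_ring_1 fps \<Rightarrow> 'a poly" where
  "iwasawa_numerator f =
     (THE g. (1 + fps_X) ^ iwasawa_exponent f * f = fps_X * fps_of_poly g)"

definition distinguished :: "'p :: prime_card padic_int poly \<Rightarrow> bool" where
  "distinguished P \<longleftrightarrow> lead_coeff P = 1 \<and> (\<forall>i < degree P. of_nat CARD('p) dvd poly.coeff P i)"

definition weierstrass_factorization ::
  "'p :: prime_card padic_int poly \<Rightarrow> nat \<Rightarrow> 'p padic_int poly \<Rightarrow> 'p padic_int fps \<Rightarrow> bool"
where
  "weierstrass_factorization g m P u \<longleftrightarrow>
     distinguished P \<and> u dvd 1 \<and> fps_of_poly g = of_nat CARD('p) ^ m * fps_of_poly P * u"

definition mu_invariant ::
  "('v, 'e) pre_digraph \<Rightarrow> ('e \<Rightarrow> 'p :: prime_card padic_int) \<Rightarrow> nat"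
where
  "mu_invariant X \<alpha> =
     (THE m. \<exists>P u. weierstrass_factorization (iwasawa_numerator (iwasawa_poly X \<alpha>)) m P u)"

definition lambda_invariant ::
  "('v, 'e) pre_digraph \<Rightarrow> ('e \<Rightarrow> 'p :: prime_card padic_int) \<Rightarrow> nat"
where
  "lambda_invariant X \<alpha> =
     (THE d. \<exists>m P u. weierstrass_factorization (iwasawa_numerator (iwasawa_poly X \<alpha>)) m P u \<and>
                     d = degree P)"

lemma iwasawa_poly_eq:
  assumes "distinct vs" "set vs = verts X"
  shows "iwasawa_poly X \<alpha> = det (iwasawa_matrix X \<alpha> vs)"
proof -
  define ws where "ws = (SOME vs. distinct vs \<and> set vs = verts X)"
  have ws: "distinct ws" "set ws = verts X"
    using someI[of "\<lambda>vs. distinct vs \<and> set vs = verts X" vs] assms unfolding ws_def by auto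
  define n where "n = length vs"
  have n: "length ws = n"
    unfolding n_def using ws assms by (metis distinct_card)
  have "mset vs = mset ws"
    using ws assms by (metis set_eq_iff_mset_eq_distinct)
  then obtain p where p: "p permutes {..<n}" and vs: "permute_list p ws = vs"
    using mset_eq_permutation n by metis
  have p0: "p permutes {0..<n}" using p by (simp add: atLeast0LessThan)
  have pn: "p i < n" if "i < n" for i using p that permutes_in_image by fastforce
  have nth: "vs ! i = ws ! p i" if "i < n" for i
    using that vs p n by (metis permute_list_nth)
  have inj: "p i = p j \<longleftrightarrow> i = j" for i j
    using p by (metis permutes_inverses(2))
  let ?A = "iwasawa_matrix X \<alpha> ws"
  let ?B = "mat n n (\<lambda>(i, j). ?A $$ (p i, j))"
  have A: "?A \<in> carrier_mat n n" by (simp add: iwasawa_matrix_def n)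
  have "iwasawa_matrix X \<alpha> vs = transpose_mat (mat n n (\<lambda>(i, j). transpose_mat ?B $$ (p i, j)))"
    by (rule eq_matI) (auto simp: iwasawa_matrix_def n n_def[symmetric] nth pn inj)
  also have "det \<dots> = det (mat n n (\<lambda>(i, j). transpose_mat ?B $$ (p i, j)))"
    by (rule det_transpose[of _ n]) simp
  also have "\<dots> = signof p * det (transpose_mat ?B)"
    by (rule det_permute_rows[OF _ p0]) simp
  also have "det (transpose_mat ?B) = det ?B"
    by (rule det_transpose[of _ n]) simp
  also have "det ?B = signof p * det ?A"
    by (rule det_permute_rows[OF A p0])
  also have "signof p * (signof p * det ?A) = det ?A"
    by (simp add: sign_def)
  finally show ?thesis by (simp add: iwasawa_poly_def ws_def)
qed

text \<open>
  For the Cayley graph this is the matrix with entries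
  \<open>r \<delta>\<^sub>i\<^sub>j - \<delta>\<^sub>S(g\<^sub>i g\<^sub>j\<^sup>-\<^sup>1) (1 + T) ^ \<beta>(g\<^sub>i g\<^sub>j\<^sup>-\<^sup>1)\<close>, where \<open>r\<close> is the cardinality of \<open>S\<close>.
\<close>

lemma iwasawa_matrix_cayley:
  assumes "group G" "S \<subseteq> carrier G" "set gs = carrier G"
  shows "iwasawa_matrix (cayley_graph G S) (cayley_voltage G \<beta>) gs =
    mat (length gs) (length gs) (\<lambda>(i, j).
      of_nat (card S) * (if i = j then 1 else 0)
        - (if gs ! i \<otimes>\<^bsub>G\<^esub> inv\<^bsub>G\<^esub> (gs ! j) \<in> S then 1 else 0)
            * one_plus_T_pow (\<beta> (gs ! i \<otimes>\<^bsub>G\<^esub> inv\<^bsub>G\<^esub> (gs ! j))))"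
proof -
  interpret group G by fact
  have deg: "out_degree (cayley_graph G S) x = card S" if x: "x \<in> carrier G" for x
  proof -
    have s: "x \<otimes>\<^bsub>G\<^esub> inv\<^bsub>G\<^esub> (inv\<^bsub>G\<^esub> s \<otimes>\<^bsub>G\<^esub> x) = s" if "s \<in> S" for s
    proof -
      have sG: "s \<in> carrier G" using that assms(2) by blast
      then have "x \<otimes>\<^bsub>G\<^esub> inv\<^bsub>G\<^esub> (inv\<^bsub>G\<^esub> s \<otimes>\<^bsub>G\<^esub> x) = x \<otimes>\<^bsub>G\<^esub> (inv\<^bsub>G\<^esub> x \<otimes>\<^bsub>G\<^esub> s)"
        using x by (simp add: inv_mult_group)
      also have "\<dots> = s"
        using x sG m_assoc[of x "inv\<^bsub>G\<^esub> x" s] by simp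
      finally show ?thesis .
    qed
    have y: "inv\<^bsub>G\<^esub> (x \<otimes>\<^bsub>G\<^esub> inv\<^bsub>G\<^esub> y) \<otimes>\<^bsub>G\<^esub> x = y" if "y \<in> carrier G" for y
      using that x by (simp add: inv_mult_group m_assoc)
    have "bij_betw (\<lambda>e. x \<otimes>\<^bsub>G\<^esub> inv\<^bsub>G\<^esub> (snd e)) (out_arcs (cayley_graph G S) x) S"
    proof (rule bij_betw_byWitness[where f' = "\<lambda>s. (x, inv\<^bsub>G\<^esub> s \<otimes>\<^bsub>G\<^esub> x)"])
      show "(\<lambda>s. (x, inv\<^bsub>G\<^esub> s \<otimes>\<^bsub>G\<^esub> x)) ` S \<subseteq> out_arcs (cayley_graph G S) x"
        using x assms(2) s by (auto simp: cayley_graph_def in_out_arcs_conv)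
    qed (use s y in \<open>auto simp: cayley_graph_def in_out_arcs_conv\<close>)
    then show ?thesis unfolding out_degree_def by (rule bij_betw_same_card)
  qed
  have arcs: "{e. e \<in> arcs (cayley_graph G S) \<and> tail (cayley_graph G S) e = x
                \<and> head (cayley_graph G S) e = y} = (if x \<otimes>\<^bsub>G\<^esub> inv\<^bsub>G\<^esub> y \<in> S then {(x, y)} else {})"
    if "x \<in> carrier G" "y \<in> carrier G" for x y
    using that by (auto simp: cayley_graph_def)
  have "gs ! i \<in> carrier G" if "i < length gs" for i
    using that assms(3) nth_mem by blast
  then show ?thesis
    unfolding iwasawa_matrix_def
    by (intro cong_mat) (auto simp: deg arcs cayley_voltage_def)
qed

end

theory Submission
  imports Defs
begin

text \<open>
  All rows of the Iwasawa matrix have the same sum \<open>c = \<Sum>\<^sub>s (1 - (1 + T)\<^bsup>\<beta>(s)\<^esup>)\<close>, so its determinant is \<open>c\<close>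
  times the determinant of the matrix whose first column is replaced by ones; for the complete graph
  the latter has constant term \<open>n\<^bsup>n-1\<^esup>\<close>, an \<open>\<ell>\<close>-adic unit. As \<open>\<beta>\<close> is odd, \<open>\<Sum>\<^sub>s \<beta>(s) = 0\<close>, hence \<open>c\<close> starts with
  \<open>- Q T\<^sup>2\<close> where \<open>2 Q = \<Sum>\<^sub>s \<beta>(s)\<^sup>2\<close> is a unit. Thus \<open>f\<close> is \<open>T\<^sup>2\<close> times a unit power series, and \<open>g\<close> is \<open>T\<close>
  times a unit, whose distinguished polynomial is \<open>T\<close>.
\<close>

section \<open>Determinants by column operations\<close>

text \<open>Right multiplication by the unipotent \<open>U\<close> adds all columns to the first,
  which becomes constantly \<open>c\<close>; this scalar then splits off as the determinant of the
  diagonal matrix \<open>D\<close>.\<close>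

lemma det_const_row_sum:
  fixes A :: "'a :: comm_ring_1 mat"
  assumes A: "A \<in> carrier_mat n n" and n: "0 < n"
    and sum: "\<And>i. i < n \<Longrightarrow> (\<Sum>j = 0..<n. A $$ (i, j)) = c"
  shows "det A = c * det (mat n n (\<lambda>(i, j). if j = 0 then 1 else A $$ (i, j)))"
proof -
  let ?A' = "mat n n (\<lambda>(i, j). if j = 0 then 1 else A $$ (i, j))"
  define U :: "'a mat" where "U = mat n n (\<lambda>(i, j). if j = 0 \<or> i = j then 1 else 0)"
  define D :: "'a mat" where "D = mat n n (\<lambda>(i, j). if i = j then if j = 0 then c else 1 else 0)"
  have U: "U \<in> carrier_mat n n" and D: "D \<in> carrier_mat n n" by (auto simp: U_def D_def)
  have "diag_mat U = replicate n 1"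
    by (rule nth_equalityI) (auto simp: U_def diag_mat_def)
  then have detU: "det U = 1"
    by (subst det_lower_triangular[OF _ U]) (auto simp: U_def)
  have "diag_mat D = c # replicate (n - 1) 1"
    using n by (intro nth_equalityI) (auto simp: D_def diag_mat_def nth_Cons')
  then have detD: "det D = c"
    by (subst det_lower_triangular[OF _ D]) (auto simp: D_def)
  have "A * U = ?A' * D"
  proof (rule eq_matI)
    fix i j assume "i < dim_row (?A' * D)" "j < dim_col (?A' * D)"
    then have ij: "i < n" "j < n" using D by auto
    have "(A * U) $$ (i, j) = (\<Sum>k = 0..<n. A $$ (i, k) * (if j = 0 \<or> k = j then 1 else 0))"
      using ij A by (simp add: scalar_prod_def U_def)
    also have "\<dots> = (if j = 0 then c else A $$ (i, j))"
      using ij sum[OF ij(1)] by (simp add: sum.delta' if_distrib[of "\<lambda>x. _ * x"] cong: if_cong)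
    also have "\<dots> = (\<Sum>k = 0..<n. if k = j then if j = 0 then c else A $$ (i, j) else 0)"
      using ij by simp
    also have "\<dots> = (\<Sum>k = 0..<n. ?A' $$ (i, k) * D $$ (k, j))"
      using ij by (intro sum.cong) (auto simp: D_def)
    also have "\<dots> = (?A' * D) $$ (i, j)"
      using ij D by (simp add: scalar_prod_def)
    finally show "(A * U) $$ (i, j) = (?A' * D) $$ (i, j)" .
  qed (use A U D in auto)
  then have "det A * det U = det ?A' * det D"
    using det_mult[OF A U] det_mult[OF _ D, of ?A'] by simp
  then show ?thesis by (simp add: detU detD mult.commute)
qed

text \<open>Adding the first column, all ones, to each other column (\<open>?B * V\<close>) cancels
  every -1 and leaves the lower triangular \<open>L\<close> with diagonal 1, a, ..., a. With
  \<open>a = n\<close> this is the cofactor of the complete graph at T = 0.\<close>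

lemma det_scalar_minus_all_ones_col_ones:
  fixes a :: "'a :: comm_ring_1"
  assumes n: "0 < n"
  shows "det (mat n n (\<lambda>(i, j). if j = 0 then 1 else (if i = j then a else 0) - 1)) = a ^ (n - 1)"
    (is "det ?B = _")
proof -
  define V :: "'a mat" where "V = mat n n (\<lambda>(i, j). if i = 0 \<or> i = j then 1 else 0)"
  define L :: "'a mat" where "L = mat n n (\<lambda>(i, j). if j = 0 then 1 else if i = j then a else 0)"
  have V: "V \<in> carrier_mat n n" and L: "L \<in> carrier_mat n n" by (auto simp: V_def L_def)
  have "diag_mat V = replicate n 1"
    by (rule nth_equalityI) (auto simp: V_def diag_mat_def)
  then have detV: "det V = 1"
    by (subst det_upper_triangular[OF _ V]) (auto simp: V_def upper_triangular_def)
  have "diag_mat L = 1 # replicate (n - 1) a"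
    using n by (intro nth_equalityI) (auto simp: L_def diag_mat_def nth_Cons')
  then have detL: "det L = a ^ (n - 1)"
    by (subst det_lower_triangular[OF _ L]) (auto simp: L_def)
  have "?B * V = L"
  proof (rule eq_matI)
    fix i j assume "i < dim_row L" "j < dim_col L"
    then have ij: "i < n" "j < n" using L by auto
    have "(?B * V) $$ (i, j) = (\<Sum>k = 0..<n. (if k = 0 then 1 else (if i = k then a else 0) - 1)
             * (if k = 0 \<or> k = j then 1 else 0))"
      using ij by (simp add: scalar_prod_def V_def)
    \<comment> \<open>The contributions of k = 0 and k = j coincide when j = 0, so the second is set
      to 0 there.\<close>
    also have "\<dots> = (\<Sum>k = 0..<n. (if k = 0 then 1 else 0)
             + (if k = j then if j = 0 then 0 else (if i = j then a else 0) - 1 else 0))"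
      by (intro sum.cong) auto
    also have "\<dots> = L $$ (i, j)"
      using ij n by (simp add: sum.distrib L_def)
    finally show "(?B * V) $$ (i, j) = L $$ (i, j)" .
  qed (use V L in auto)
  then show ?thesis
    using det_mult[OF _ V, of ?B] by (simp add: detV detL)
qed

section \<open>Powers of 1 + T with \<ell>-adic exponent\<close>

lemma padic_binomial_0: "padic_binomial (b :: 'p :: prime_card padic_int) 0 = 1"
  using fact_times_padic_binomial[of 0 b] by simp

lemma padic_binomial_1: "padic_binomial (b :: 'p :: prime_card padic_int) (Suc 0) = b"
  using fact_times_padic_binomial[of "Suc 0" b] by simp

lemma two_times_padic_binomial_2:
  "2 * padic_binomial (b :: 'p :: prime_card padic_int) 2 = b ^ 2 - b"
  using fact_times_padic_binomial[of 2 b]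
  by (simp add: numeral_2_eq_2 algebra_simps)

text \<open>Pascal's rule. Multiplied by \<open>fact (Suc k)\<close> it is an identity between
  falling factorials; the factorial cancels because the \<ell>-adic integers form a domain of
  characteristic 0.\<close>

lemma padic_binomial_Suc_Suc:
  fixes b :: "'p :: prime_card padic_int"
  shows "padic_binomial (b + 1) (Suc k) = padic_binomial b (Suc k) + padic_binomial b k"
proof -
  let ?P = "\<Prod>i = 0..<k. b - of_nat i"
  \<comment> \<open>The factor i = 0 of the falling factorial of \<open>b + 1\<close> is
    \<open>b + 1\<close> itself; the others are those of \<open>b\<close>.\<close>
  have "fact (Suc k) * padic_binomial (b + 1) (Suc k) = (b + 1) * ?P"
    unfolding fact_times_padic_binomial by (subst prod.atLeast0_lessThan_Suc_shift) simp
  also have "\<dots> = ?P * (b - of_nat k) + of_nat (Suc k) * ?P"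
    by (simp add: algebra_simps)
  also have "\<dots> = fact (Suc k) * padic_binomial b (Suc k) + of_nat (Suc k) * (fact k * padic_binomial b k)"
    unfolding fact_times_padic_binomial by simp
  also have "\<dots> = fact (Suc k) * (padic_binomial b (Suc k) + padic_binomial b k)"
    by (simp add: algebra_simps)
  finally show ?thesis
    using fact_nonzero[of "Suc k", where 'a = "'p padic_int"] mult_left_cancel by blast
qed

lemma one_plus_T_pow_add_1:
  "one_plus_T_pow (b + 1 :: 'p :: prime_card padic_int) = (1 + fps_X) * one_plus_T_pow b"
proof (rule fps_ext)
  fix k
  show "fps_nth (one_plus_T_pow (b + 1)) k = fps_nth ((1 + fps_X) * one_plus_T_pow b) k"
    by (cases k) (simp_all add: one_plus_T_pow_def distrib_right padic_binomial_Suc_Suc padic_binomial_0)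
qed

lemma one_plus_T_pow_add_of_nat:
  "one_plus_T_pow (b + of_nat k :: 'p :: prime_card padic_int) = (1 + fps_X) ^ k * one_plus_T_pow b"
proof (induction k)
  case (Suc k)
  have "b + of_nat (Suc k) = (b + of_nat k) + 1" by simp
  then show ?case by (simp only: one_plus_T_pow_add_1 Suc.IH power_Suc mult.assoc)
qed simp

lemma one_plus_T_pow_0: "one_plus_T_pow (0 :: 'p :: prime_card padic_int) = 1"
proof (rule fps_ext)
  fix k
  have "fact k * padic_binomial 0 k = fact k * (if k = 0 then 1 else (0 :: 'p padic_int))"
    unfolding fact_times_padic_binomial by (auto intro!: bexI[of _ 0])
  then show "fps_nth (one_plus_T_pow (0 :: 'p padic_int)) k = fps_nth 1 k"
    by (simp add: one_plus_T_pow_def)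
qed

text \<open>The exponent \<open>b + int K\<close> is a natural number, so the product is an ordinary
  power of 1 + T. \<open>K\<close> is only bounded below so that one \<open>K\<close> can serve all
  values of \<beta>.\<close>

lemma one_plus_T_pow_of_int_numerator:
  assumes "nat (- b) \<le> K"
  shows "\<exists>q. (1 + fps_X) ^ K * one_plus_T_pow (of_int b :: 'p :: prime_card padic_int) = fps_of_poly q"
proof -
  have "(1 + fps_X) ^ K * one_plus_T_pow (of_int b :: 'p padic_int)
      = one_plus_T_pow (0 + of_nat (nat (b + int K)))"
    using assms by (subst one_plus_T_pow_add_of_nat[symmetric]) (simp add: of_nat_nat)
  also have "\<dots> = fps_of_poly ([:1, 1:] ^ nat (b + int K))"
    unfolding one_plus_T_pow_add_of_nat
    by (simp add: one_plus_T_pow_0 fps_of_poly_power fps_of_poly_pCons algebra_simps)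
  finally show ?thesis by blast
qed

section \<open>Units and Weierstrass factorizations\<close>

lemma fps_is_unit_if_nth_0_is_unit:
  fixes f :: "'a :: comm_ring_1 fps"
  assumes "fps_nth f 0 dvd 1"
  shows "f dvd 1"
proof -
  obtain y where "fps_nth f 0 * y = 1" using assms by (metis dvd_def)
  then have "f * fps_right_inverse f y = 1" by (rule fps_right_inverse)
  then show ?thesis by (metis dvd_triv_left)
qed

text \<open>The absolute value of the underlying integer is a natural number prime to \<ell>, hence
  a unit; a sign does not affect this.\<close>

lemma padic_Ints_is_unit:
  assumes "x \<in> \<int>" "\<not> of_nat CARD('p) dvd (x :: 'p :: prime_card padic_int)"
  shows "x dvd 1"
proof -
  obtain k where k: "x = of_int k" using assms(1) by (auto elim: Ints_cases)
  have "\<not> CARD('p) dvd nat \<bar>k\<bar>"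
  proof
    assume "CARD('p) dvd nat \<bar>k\<bar>"
    then obtain d where "nat \<bar>k\<bar> = CARD('p) * d" by (auto simp: dvd_def)
    then have "k = int CARD('p) * (sgn k * int d)"
      by (metis abs_sgn_eq abs_ge_zero int_nat_eq mult.assoc mult.commute mult_sgn_abs of_nat_mult)
    then have "x = of_nat CARD('p) * of_int (sgn k * int d)"
      unfolding k by (metis of_int_mult of_int_of_nat_eq)
    then show False using assms(2) by simp
  qed
  then have "(of_nat (nat \<bar>k\<bar>) :: 'p padic_int) dvd 1"
    by (rule is_unit_padic_int_of_nat)
  moreover have "(of_nat (nat \<bar>k\<bar>) :: 'p padic_int) = x \<or> of_nat (nat \<bar>k\<bar>) = - x"
    by (auto simp: k abs_if of_nat_nat)
  ultimately show ?thesis by auto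
qed

lemma not_is_unit_padic_card: "\<not> (of_nat CARD('p) :: 'p :: prime_card padic_int) dvd 1"
proof -
  have "1 < int CARD('p)"
    using prime_gt_1_nat[OF prime_card[where 'a = 'p]] by simp
  then show ?thesis
    using card_pow_dvd_padic_int_iff[of 1 "1 :: 'p padic_int"] by (simp add: padic_res_1)
qed

text \<open>The coefficient of T in \<open>fps_X * v\<close> is a unit. If \<open>m > 0\<close> or
  \<open>degree P \<ge> 2\<close>, then \<ell> would divide it; if \<open>degree P = 0\<close>, then
  \<open>P = 1\<close> and \<open>fps_X * v\<close> would be a unit with constant term 0. Covering
  every factorization provides the uniqueness that the \<open>THE\<close> in both invariants
  requires.\<close>

lemma weierstrass_factorization_X_times_unit:
  fixes g :: "'p :: prime_card padic_int poly"
  assumes g: "fps_of_poly g = fps_X * v" and v: "v dvd 1"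
  shows "weierstrass_factorization g m P u \<Longrightarrow> m = 0 \<and> degree P = 1"
    and "weierstrass_factorization g 0 [:0, 1:] v"
proof -
  let ?l = "of_nat CARD('p) :: 'p padic_int"
  show "weierstrass_factorization g 0 [:0, 1:] v"
    using g v by (auto simp: weierstrass_factorization_def distinguished_def fps_of_poly_pCons)
  assume W: "weierstrass_factorization g m P u"
  then have P: "distinguished P" and eq: "fps_X * v = of_nat CARD('p) ^ m * fps_of_poly P * u"
    using g by (auto simp: weierstrass_factorization_def)
  obtain w where "v * w = 1" using v by (metis dvd_def)
  then have "fps_nth v 0 * fps_nth w 0 = 1"
    by (metis fps_mult_nth_0 fps_one_nth)
  then have "fps_nth v 0 dvd 1" by (metis dvd_triv_left)
  then have nd: "\<not> ?l dvd fps_nth (fps_X * v) 1"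
    using not_is_unit_padic_card[where 'p = 'p] dvd_trans by auto
  have const: "of_nat CARD('p) ^ k = fps_const (?l ^ k)" for k
    by (simp add: fps_of_nat flip: fps_const_power)
  have nth: "fps_nth (fps_X * v) i = ?l ^ m * fps_nth (fps_of_poly P * u) i" for i
    unfolding eq const mult.assoc by simp
  have m: "m = 0"
  proof (rule ccontr)
    assume "m \<noteq> 0"
    then show False using nd unfolding nth by (simp add: dvd_power)
  qed
  have "degree P < 2"
  proof (rule ccontr)
    assume "\<not> degree P < 2"
    then have "?l dvd poly.coeff P 0" "?l dvd poly.coeff P 1"
      using P by (auto simp: distinguished_def)
    then have "?l dvd fps_nth (fps_of_poly P * u) 1"
      by (simp add: fps_mult_nth_1)
    then show False using nd unfolding nth m by simp
  qed
  moreover have "degree P \<noteq> 0"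
  proof
    assume "degree P = 0"
    then have "P = 1" using P by (metis distinguished_def degree_0_id one_pCons)
    moreover have "u dvd 1" using W by (simp add: weierstrass_factorization_def)
    ultimately have "fps_X * v dvd 1" using eq m by simp
    then obtain w where "fps_X * v * w = 1" by (metis dvd_def)
    then have "fps_nth (fps_X * v * w) 0 = 1" by simp
    then show False by simp
  qed
  ultimately show "m = 0 \<and> degree P = 1" using m by simp
qed

text \<open>For whichever exponent m is minimal, (1 + T)^m has constant term 1, so cancelling one T
  leaves T times the unit (1 + T)^m h.\<close>

lemma iwasawa_numerator_X_squared_times_unit:
  fixes f :: "'a :: idom fps"
  assumes f: "f = fps_X ^ 2 * h" and h: "fps_nth h 0 dvd 1"
    and ex: "(1 + fps_X) ^ k * f = fps_of_poly q"
  obtains v where "v dvd 1" "fps_of_poly (iwasawa_numerator f) = fps_X * v"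
proof -
  have "poly.coeff q 0 = fps_nth (fps_of_poly q) 0" by simp
  also have "\<dots> = 0" by (simp add: f flip: ex)
  \<comment> \<open>Dividing \<open>q\<close> by T exhibits \<open>k\<close> as an admissible
    exponent, so the \<open>LEAST\<close> is attained.\<close>
  finally have "q = pCons 0 (poly_shift 1 q)"
    by (intro poly_eqI) (simp add: coeff_pCons coeff_poly_shift split: nat.split)
  then have "(1 + fps_X) ^ k * f = fps_X * fps_of_poly (poly_shift 1 q)"
    unfolding ex by (metis fps_of_poly_pCons fps_const_0_eq_0 add_0_left mult.commute)
  then have "\<exists>g. (1 + fps_X) ^ iwasawa_exponent f * f = fps_X * fps_of_poly g"
    unfolding iwasawa_exponent_def
    by (intro LeastI[of "\<lambda>m. \<exists>g. (1 + fps_X) ^ m * f = fps_X * fps_of_poly g" k] exI)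
  then obtain g where g: "(1 + fps_X) ^ iwasawa_exponent f * f = fps_X * fps_of_poly g" by blast
  \<comment> \<open>Uniqueness for the \<open>THE\<close>: T cancels in the domain of power
    series.\<close>
  have num: "iwasawa_numerator f = g"
    unfolding iwasawa_numerator_def using g
    by (intro the_equality) (auto simp: fps_of_poly_eq_iff)
  let ?v = "(1 + fps_X) ^ iwasawa_exponent f * h"
  have "fps_X * fps_of_poly g = fps_X * (fps_X * ?v)"
    unfolding g[symmetric] by (subst (2) f) (simp only: power2_eq_square ac_simps)
  then have "fps_of_poly g = fps_X * ?v"
    using mult_left_cancel[OF fps_X_neq_zero] by blast
  moreover have "?v dvd 1"
    using h by (intro fps_is_unit_if_nth_0_is_unit) (simp add: fps_power_zeroth)
  ultimately show ?thesis using that num by blast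
qed

section \<open>Iwasawa polynomials of Cayley graphs\<close>

text \<open>This is why all rows of a Cayley matrix have the same sum: each runs through the same
  values in a different order.\<close>

lemma (in group) sum_mult_inv_right:
  fixes F :: "'a \<Rightarrow> 'c :: comm_monoid_add"
  assumes "x \<in> carrier G"
  shows "(\<Sum>y\<in>carrier G. F (x \<otimes> inv y)) = (\<Sum>s\<in>carrier G. F s)"
proof (rule sum.reindex_bij_witness[where i = "\<lambda>s. inv s \<otimes> x" and j = "\<lambda>y. x \<otimes> inv y"])
  fix s assume "s \<in> carrier G"
  with assms show "x \<otimes> inv (inv s \<otimes> x) = s"
    by (simp add: inv_mult_group m_assoc[symmetric])
qed (use assms in \<open>simp_all add: inv_mult_group m_assoc\<close>)

text \<open>As \<beta> takes integer values, one power of 1 + T clears the negative exponents in all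
  entries; the determinant is then scaled by a power of that factor.\<close>

lemma iwasawa_poly_cayley_numerator_ex:
  fixes \<beta> :: "'g \<Rightarrow> 'p :: prime_card padic_int"
  assumes "group G" "S \<subseteq> carrier G" "finite (carrier G)" "\<beta> ` S \<subseteq> \<int>"
  shows "\<exists>k q. (1 + fps_X) ^ k * iwasawa_poly (cayley_graph G S) (cayley_voltage G \<beta>) = fps_of_poly q"
proof -
  obtain gs where gs: "distinct gs" "set gs = carrier G"
    using finite_distinct_list assms(3) by blast
  define N where "N = length gs"
  define A where "A = iwasawa_matrix (cayley_graph G S) (cayley_voltage G \<beta>) gs"
  have A: "A \<in> carrier_mat N N" by (simp add: A_def N_def iwasawa_matrix_def)
  have "\<forall>s\<in>S. \<exists>b. \<beta> s = of_int b" using assms(4) by (auto simp: Ints_def)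
  then obtain b where b: "\<And>s. s \<in> S \<Longrightarrow> \<beta> s = of_int (b s)" by metis
  \<comment> \<open>A sum of naturals dominates each of its terms, so \<open>K\<close> is a common
    bound.\<close>
  define K where "K = (\<Sum>s\<in>S. nat (- b s))"
  have fin: "finite S" using assms finite_subset by blast
  have "\<exists>q. (1 + fps_X) ^ K * one_plus_T_pow (\<beta> s) = fps_of_poly q" if "s \<in> S" for s
    unfolding b[OF that] K_def
    by (intro one_plus_T_pow_of_int_numerator member_le_sum) (use that fin in auto)
  then obtain Q where Q: "\<And>s. s \<in> S \<Longrightarrow> (1 + fps_X) ^ K * one_plus_T_pow (\<beta> s) = fps_of_poly (Q s)"
    by metis
  define B where "B = mat N N (\<lambda>(i, j). (if i = j then of_nat (card S) * [:1, 1:] ^ K else 0)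
    - (if gs ! i \<otimes>\<^bsub>G\<^esub> inv\<^bsub>G\<^esub> (gs ! j) \<in> S then Q (gs ! i \<otimes>\<^bsub>G\<^esub> inv\<^bsub>G\<^esub> (gs ! j)) else 0))"
  have X: "fps_of_poly [:1, 1:] = (1 + fps_X :: 'p padic_int fps)"
    by (simp add: fps_of_poly_pCons)
  \<comment> \<open>The homomorphism moves \<open>det\<close> inside
    \<open>fps_of_poly\<close>.\<close>
  interpret comm_ring_hom "fps_of_poly :: 'p padic_int poly \<Rightarrow> _"
    by standard (simp_all add: fps_of_poly_add fps_of_poly_mult)
  have "(1 + fps_X) ^ K \<cdot>\<^sub>m A = map_mat fps_of_poly B"
    unfolding A_def iwasawa_matrix_cayley[OF assms(1,2) gs(2)]
    by (rule eq_matI)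
       (auto simp: B_def N_def right_diff_distrib Q X fps_of_poly_diff fps_of_poly_mult
         fps_of_poly_power fps_of_poly_uminus of_nat_poly fps_of_poly_smult fps_of_nat mult.commute)
  then have "((1 + fps_X) ^ K) ^ N * det A = fps_of_poly (det B)"
    using det_smult[of "(1 + fps_X) ^ K" A] A by (simp add: hom_det)
  moreover have "iwasawa_poly (cayley_graph G S) (cayley_voltage G \<beta>) = det A"
    unfolding A_def by (intro iwasawa_poly_eq) (simp_all add: gs cayley_graph_def)
  ultimately show ?thesis by (metis power_mult)
qed

text \<open>The factor \<open>d\<close> is the determinant with the first column replaced by ones.
  Its constant term is computed at T = 0, where the original matrix is n times the identity minus
  the all-ones matrix.\<close>

lemma iwasawa_poly_complete_graph:
  fixes G :: "('g, 'm) monoid_scheme" (structure)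
    and \<beta> :: "'g \<Rightarrow> 'p :: prime_card padic_int"
  defines "S \<equiv> carrier G - {\<one>}"
  assumes G: "group G" "finite (carrier G)"
  obtains d where
    "iwasawa_poly (cayley_graph G S) (cayley_voltage G \<beta>) = (\<Sum>s\<in>S. 1 - one_plus_T_pow (\<beta> s)) * d"
    "fps_nth d 0 = of_nat (order G) ^ (order G - 1)"
proof -
  interpret group G by fact
  obtain gs where gs: "distinct gs" "set gs = carrier G"
    using finite_distinct_list G(2) by blast
  define N where "N = length gs"
  have N: "N = order G" using gs by (simp add: N_def order_def flip: distinct_card)
  have Npos: "0 < N" using G N by (simp add: order_gt_0_iff_finite)
  have cardS: "card S = N - 1" using G by (simp add: S_def N order_def)
  define A where "A = iwasawa_matrix (cayley_graph G S) (cayley_voltage G \<beta>) gs"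
  \<comment> \<open>Extension by zero to the identity lets the row sums run over the whole
    group.\<close>
  define F where "F = (\<lambda>s. if s \<in> S then one_plus_T_pow (\<beta> s) else 0)"
  have A: "A \<in> carrier_mat N N" by (simp add: A_def N_def iwasawa_matrix_def)
  have gsG: "gs ! i \<in> carrier G" if "i < N" for i
    using that gs(2) nth_mem unfolding N_def by blast
  have entry: "A $$ (i, j) = (if i = j then of_nat (card S) else 0) - F (gs ! i \<otimes> inv (gs ! j))"
    if "i < N" "j < N" for i j
    using that unfolding A_def
    by (subst iwasawa_matrix_cayley[OF G(1) _ gs(2)]) (auto simp: S_def F_def N_def)
  have row: "(\<Sum>j = 0..<N. A $$ (i, j)) = (\<Sum>s\<in>S. 1 - one_plus_T_pow (\<beta> s))" if i: "i < N" for i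
  proof -
    have "(\<Sum>j = 0..<N. A $$ (i, j)) = of_nat (card S) - (\<Sum>j = 0..<N. F (gs ! i \<otimes> inv (gs ! j)))"
      using i by (simp add: entry sum_subtractf)
    also have "(\<Sum>j = 0..<N. F (gs ! i \<otimes> inv (gs ! j))) = (\<Sum>y\<in>carrier G. F (gs ! i \<otimes> inv y))"
      using bij_betw_nth[OF gs(1) refl gs(2)[symmetric]]
      by (intro sum.reindex_bij_betw) (simp add: N_def atLeast0LessThan)
    also have "\<dots> = (\<Sum>s\<in>carrier G. F s)"
      by (rule sum_mult_inv_right[OF gsG[OF i]])
    also have "\<dots> = (\<Sum>s\<in>S. one_plus_T_pow (\<beta> s))"
      using G(2) by (intro sum.mono_neutral_cong_right) (auto simp: F_def S_def)
    finally show ?thesis by (simp add: sum_subtractf)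
  qed
  define d where "d = det (mat N N (\<lambda>(i, j). if j = 0 then 1 else A $$ (i, j)))"
  interpret comm_ring_hom "\<lambda>f :: 'p padic_int fps. fps_nth f 0"
    by standard simp_all
  have diff: "gs ! i \<otimes> inv (gs ! j) \<in> S \<longleftrightarrow> i \<noteq> j" if "i < N" "j < N" for i j
  proof -
    have "gs ! i \<otimes> inv (gs ! j) = \<one> \<longleftrightarrow> gs ! i = gs ! j"
      using gsG[OF that(1)] gsG[OF that(2)] by (metis inv_closed inv_inv inv_equality r_inv)
    then show ?thesis
      using gsG[OF that(1)] gsG[OF that(2)] that gs(1)
      by (simp add: S_def nth_eq_iff_index_eq N_def)
  qed
  \<comment> \<open>At T = 0 the diagonal entry is the degree N - 1, as there are no loops, and
    every other entry is -1.\<close>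
  have "map_mat (\<lambda>f. fps_nth f 0) (mat N N (\<lambda>(i, j). if j = 0 then 1 else A $$ (i, j)))
      = mat N N (\<lambda>(i, j). if j = 0 then 1 else (if i = j then of_nat N else 0) - 1)"
    using Npos
    by (intro eq_matI)
       (auto simp: entry F_def diff cardS one_plus_T_pow_def padic_binomial_0 
         simp flip: fps_of_nat)
  then have "fps_nth d 0 = of_nat N ^ (N - 1)"
    unfolding d_def hom_det[symmetric] by (simp add: det_scalar_minus_all_ones_col_ones[OF Npos])
  moreover have "iwasawa_poly (cayley_graph G S) (cayley_voltage G \<beta>) = det A"
    unfolding A_def by (intro iwasawa_poly_eq) (simp_all add: gs cayley_graph_def)
  moreover have "det A = (\<Sum>s\<in>S. 1 - one_plus_T_pow (\<beta> s)) * d"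
    unfolding d_def by (rule det_const_row_sum[OF A Npos row])
  ultimately show ?thesis using that unfolding N by metis
qed

section \<open>The invariants of the complete graph\<close>

theorem theorem4p12:
  fixes G :: "('g, 'm) monoid_scheme" (structure)
    and n :: nat
    and \<beta> :: "'g \<Rightarrow> 'p :: prime_card padic_int"
    and C' :: "'g set"
  defines "C' \<equiv> carrier G - {\<one>}"
  assumes n: "n \<ge> 4"
    and G: "group G" "cyclic_group G" "order G = n"
    and cond1: "Modules.module.span (*) (\<beta> ` C') = UNIV"
    and cond2: "\<forall>s\<in>C'. \<beta> (inv s) = - \<beta> s"
    and cond3: "\<beta> ` C' \<subseteq> \<int>"
    and cond4: "\<exists>m>0. \<exists>h \<in> {1..m::nat} \<rightarrow> C'. (\<Otimes>i\<in>{1..m}. h i) \<in> C' \<and>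
                  \<not> of_nat CARD('p) dvd (\<beta> (\<Otimes>i\<in>{1..m}. h i) - (\<Sum>i = 1..m. \<beta> (h i)))"
    and "\<not> CARD('p) dvd n"
    and "\<not> of_nat CARD('p) dvd (\<Sum>s\<in>C'. \<beta> s ^ 2)"
  shows "mu_invariant (cayley_graph G C') (cayley_voltage G \<beta>) = 0 \<and>
         lambda_invariant (cayley_graph G C') (cayley_voltage G \<beta>) = 1"
proof -
  interpret group G by fact
  have fin: "finite (carrier G)"
    using n G(3) order_gt_0_iff_finite by auto
  let ?f = "iwasawa_poly (cayley_graph G C') (cayley_voltage G \<beta>)"
  define c where "c = (\<Sum>s\<in>C'. 1 - one_plus_T_pow (\<beta> s))"
  obtain d where f: "?f = c * d" and d: "fps_nth d 0 = of_nat n ^ (n - 1)"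
    using iwasawa_poly_complete_graph[OF G(1) fin, of \<beta>] unfolding C'_def c_def G(3) by blast
  \<comment> \<open>Inversion permutes \<open>C'\<close>, so the odd function \<beta> sums to its
    own negative; 2 cancels in characteristic 0, whatever \<ell> is.\<close>
  have "(\<Sum>s\<in>C'. \<beta> s) = (\<Sum>s\<in>C'. \<beta> (inv s))"
    by (rule sum.reindex_bij_witness[where i = "\<lambda>s. inv s" and j = "\<lambda>s. inv s"])
       (auto simp: C'_def)
  also have "\<dots> = - (\<Sum>s\<in>C'. \<beta> s)"
    using cond2 by (simp add: sum_negf)
  finally have "2 * (\<Sum>s\<in>C'. \<beta> s) = 0"
    by (metis add.right_inverse mult_2)
  then have sum0: "(\<Sum>s\<in>C'. \<beta> s) = 0" by simp
  have nth_c: "fps_nth c k = (\<Sum>s\<in>C'. (if k = 0 then 1 else 0) - padic_binomial (\<beta> s) k)" for k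
    by (simp add: c_def fps_sum_nth one_plus_T_pow_def)
  have c2: "2 * fps_nth c 2 = - (\<Sum>s\<in>C'. \<beta> s ^ 2)"
    by (simp add: nth_c sum_negf sum_distrib_left two_times_padic_binomial_2 sum_subtractf sum0)
  \<comment> \<open>The constant terms 1 - 1 vanish, and the linear coefficient is minus the sum of
    \<beta>, which is 0.\<close>
  have "c = fps_X ^ 2 * fps_shift 2 c"
  proof (rule fps_ext)
    fix k
    consider "k = 0" | "k = Suc 0" | "k \<ge> 2" by linarith
    then show "fps_nth c k = fps_nth (fps_X ^ 2 * fps_shift 2 c) k"
    proof cases
      case 3
      then have "k - 2 + 2 = k" by simp
      then show ?thesis using 3 by (simp only: fps_X_power_mult_nth fps_shift_nth) simp
    qed (simp_all add: nth_c padic_binomial_0 padic_binomial_1 sum_negf sum0 fps_X_power_mult_nth)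
  qed
  then have f': "?f = fps_X ^ 2 * (fps_shift 2 c * d)"
    unfolding f mult.assoc[symmetric] by (rule arg_cong)
  \<comment> \<open>By condition (3) the sum of squares is an integer, so being prime to \<ell>
    makes it a unit.\<close>
  have "(\<Sum>s\<in>C'. \<beta> s ^ 2) \<in> \<int>"
    using cond3 by (intro Ints_sum Ints_power) auto
  then have "(\<Sum>s\<in>C'. \<beta> s ^ 2) dvd 1"
    using assms by (intro padic_Ints_is_unit)
  \<comment> \<open>A factor of a unit is a unit, so \<ell> = 2 requires no separate case.\<close>
  then have "2 * fps_nth c 2 dvd 1" by (simp add: c2)
  then have "fps_nth c 2 dvd 1" by (rule dvd_mult_right)
  moreover have "(of_nat n :: 'p padic_int) ^ (n - 1) dvd 1"
    using is_unit_padic_int_of_nat[of n, where 'p = 'p] assms by (simp add: is_unit_power_iff)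
  ultimately have unit: "fps_nth (fps_shift 2 c * d) 0 dvd 1"
    by (simp add: d is_unit_mult_iff numeral_2_eq_2)
  obtain k q where "(1 + fps_X) ^ k * ?f = fps_of_poly q"
    using iwasawa_poly_cayley_numerator_ex[OF G(1) _ fin cond3] by (auto simp: C'_def)
  then obtain v where v: "v dvd 1" "fps_of_poly (iwasawa_numerator ?f) = fps_X * v"
    using iwasawa_numerator_X_squared_times_unit[OF f' unit] by metis
  note W = weierstrass_factorization_X_times_unit[OF v(2,1)]
  have "mu_invariant (cayley_graph G C') (cayley_voltage G \<beta>) = 0"
    unfolding mu_invariant_def using W by (intro the_equality) blast+
  moreover have "lambda_invariant (cayley_graph G C') (cayley_voltage G \<beta>) = 1"
    unfolding lambda_invariant_def
  proof (rule the_equality)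
    \<comment> \<open>The factorization T times \<open>v\<close>, with \<mu> = 0 and P = T.\<close>
    show "\<exists>m P u. weierstrass_factorization (iwasawa_numerator ?f) m P u \<and> 1 = degree P"
      using W(2) by (intro exI[of _ 0] exI[of _ "[:0, 1:]"] exI[of _ v]) simp
  qed (use W(1) in blast)
  ultimately show ?thesis by blast
qed

end
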